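(* Let $R,S,T\in\mathcal{B}_A(\mathcal{H})$, let $n$ be an even integer, and let $$\mathbb{M}=\begin{bmatrix} R & S & \cdots & S & T\\ S & R & \cdots & T & S\\ \vdots & \vdots & & \vdots & \vdots\\ S & T & \cdots & R & S\\ T & S & \cdots & S & R\end{bmatrix}_{n\times n}$$ be the $n\times n$ operator matrix whose diagonal entries (positions $(i,i)$) all equal $R$, whose anti-diagonal entries (positions $(i,n+1-i)$) all equal $T$, and all of whose remaining entries equal $S$. Then $$w_{\mathbb{A}}(\mathbb{M})=\max\{w_A(R+T+(n-2)S),\ w_A(R+T-2S),\ w_A(R-T)\}.$$
   Context: $\mathcal{H}$ is a complex Hilbert space with inner product $\langle\cdot,\cdot\rangle$, $\mathcal{B}(\mathcal{H})$ is the algebra of bounded linear operators on $\mathcal{H}$, and $A\in\mathcal{B}(\mathcal{H})$ is a fixed positive operator ($\langle Ax,x\rangle\ge 0$ for all $x\in\mathcal{H}$). Put $\langle x,y\rangle_A=\langle Ax,y\rangle$ and $\|x\|_A=\sqrt{\langle x,x\rangle_A}$. $\mathcal{B}_A(\mathcal{H})$ is the set of $T\in\mathcal{B}(\mathcal{H})$ admitting an $A$-adjoint, i.e. for which there is $X\in\mathcal{B}(\mathcal{H})$ with $AX=T^*A$ (equivalently $\mathcal{R}(T^*A)\subseteq\mathcal{R}(A)$, where $\mathcal{R}$ denotes the range). The $A$-numerical radius is $w_A(T)=\sup\{|\langle Tx,x\rangle_A|: x\in\mathcal{H},\ \|x\|_A=1\}$. $\mathbb{A}$ denotes the $n\times n$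 block diagonal operator matrix on $\bigoplus_{i=1}^n\mathcal{H}$ all of whose diagonal entries are $A$, and $w_{\mathbb{A}}$ is the numerical radius defined in the same way with $\mathcal{H},A$ replaced by $\bigoplus_{i=1}^n\mathcal{H},\mathbb{A}$.
   Formalization: The even integer n is required to be at least 4; for n = 2 the matrix has no S entries and the formula fails (A = S = I, R = T = 0: left side 0, right side 2). *)

theory Defs
  imports "HOL-Analysis.Analysis"
begin

class scaleC =
  fixes scaleC :: "complex \<Rightarrow> 'a \<Rightarrow> 'a"  (infixr "*\<^sub>C" 75)

text \<open>The metric, the norm and completeness come from the library class \<open>banach\<close>.  The inner
  product is linear in the first argument and conjugate linear in the second one.\<close>

class chilbert_space = banach + scaleC +
  fixes cinner :: "'a \<Rightarrow> 'a \<Rightarrow> complex"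
  assumes scaleC_add_right: "c *\<^sub>C (x + y) = c *\<^sub>C x + c *\<^sub>C y"
    and scaleC_add_left: "(c + d) *\<^sub>C x = c *\<^sub>C x + d *\<^sub>C x"
    and scaleC_scaleC: "c *\<^sub>C (d *\<^sub>C x) = (c * d) *\<^sub>C x"
    and scaleC_of_real: "complex_of_real r *\<^sub>C x = r *\<^sub>R x"
    and cinner_commute: "cinner x y = cnj (cinner y x)"
    and cinner_add_left: "cinner (x + y) z = cinner x z + cinner y z"
    and cinner_scaleC_left: "cinner (c *\<^sub>C x) y = c * cinner x y"
    and cinner_nonneg: "0 \<le> Re (cinner x x)"
    and norm_eq_sqrt_cinner: "norm x = sqrt (Re (cinner x x))"

instantiation complex :: chilbert_space
begin

definition scaleC_complex_def: "c *\<^sub>C (z::complex) = c * z"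
definition cinner_complex_def: "cinner (z::complex) w = z * cnj w"

instance
  by standard
    (auto simp: scaleC_complex_def cinner_complex_def algebra_simps scaleR_conv_of_real
       cmod_def power2_eq_square)

end

text \<open>The orthogonal direct sum of finitely many copies of a Hilbert space, as the library type of
  vectors indexed by a finite type.\<close>

instantiation vec :: (chilbert_space, finite) chilbert_space
begin

definition scaleC_vec_def: "c *\<^sub>C x = (\<chi> i. c *\<^sub>C (x $ i))"
definition cinner_vec_def: "cinner x y = (\<Sum>i\<in>UNIV. cinner (x $ i) (y $ i))"

instance
proof
  fix x y z :: "'a ^ 'b" and c d :: complex and r :: real
  show "c *\<^sub>C (x + y) = c *\<^sub>C x + c *\<^sub>C y"
    by (simp add: scaleC_vec_def vec_eq_iff scaleC_add_right)
  show "(c + d) *\<^sub>C x = c *\<^sub>C x + d *\<^sub>C x"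
    by (simp add: scaleC_vec_def vec_eq_iff scaleC_add_left)
  show "c *\<^sub>C (d *\<^sub>C x) = (c * d) *\<^sub>C x"
    by (simp add: scaleC_vec_def vec_eq_iff scaleC_scaleC)
  show "complex_of_real r *\<^sub>C x = r *\<^sub>R x"
    by (simp add: scaleC_vec_def vec_eq_iff scaleC_of_real)
  show "cinner x y = cnj (cinner y x)"
    unfolding cinner_vec_def cnj_sum by (rule sum.cong[OF refl]) (rule cinner_commute)
  show "cinner (x + y) z = cinner x z + cinner y z"
    by (simp add: cinner_vec_def cinner_add_left sum.distrib)
  show "cinner (c *\<^sub>C x) y = c * cinner x y"
    by (simp add: cinner_vec_def scaleC_vec_def cinner_scaleC_left sum_distrib_left)
  show "0 \<le> Re (cinner x x)"
    by (simp add: cinner_vec_def sum_nonneg cinner_nonneg)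
  show "norm x = sqrt (Re (cinner x x))"
    by (simp add: cinner_vec_def norm_vec_def L2_set_def norm_eq_sqrt_cinner cinner_nonneg)
qed

end

definition bounded_operators :: "('a::chilbert_space \<Rightarrow> 'a) set" where
  "bounded_operators = {T. bounded_linear T \<and> (\<forall>c x. T (c *\<^sub>C x) = c *\<^sub>C T x)}"

definition positive_operator :: "('a::chilbert_space \<Rightarrow> 'a) \<Rightarrow> bool" where
  "positive_operator A \<longleftrightarrow> A \<in> bounded_operators \<and> (\<forall>x. cinner (A x) x \<in> \<real>\<^sub>\<ge>\<^sub>0)"

text \<open>\<open>is_adjoint G T\<close> says that \<open>G\<close> is the Hilbert space adjoint of \<open>T\<close>; such a \<open>G\<close> is unique,
  and it exists for every bounded operator by the Riesz representation theorem.\<close>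

definition is_adjoint :: "('a::chilbert_space \<Rightarrow> 'a) \<Rightarrow> ('a \<Rightarrow> 'a) \<Rightarrow> bool" where
  "is_adjoint G T \<longleftrightarrow> G \<in> bounded_operators \<and> (\<forall>x y. cinner (T x) y = cinner x (G y))"

definition A_adjointable :: "('a::chilbert_space \<Rightarrow> 'a) \<Rightarrow> ('a \<Rightarrow> 'a) set" where
  "A_adjointable A = {T \<in> bounded_operators.
     \<exists>X \<in> bounded_operators. \<exists>G. is_adjoint G T \<and> A \<circ> X = G \<circ> A}"

definition A_inner :: "('a::chilbert_space \<Rightarrow> 'a) \<Rightarrow> 'a \<Rightarrow> 'a \<Rightarrow> complex" where
  "A_inner A x y = cinner (A x) y"

definition A_norm :: "('a::chilbert_space \<Rightarrow> 'a) \<Rightarrow> 'a \<Rightarrow> real" where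
  "A_norm A x = sqrt (Re (A_inner A x x))"

text \<open>The supremum is taken in \<open>[0,\<infinity>]\<close>, so that it needs no side conditions: it may be infinite
  for bounded operators that are not \<open>A\<close>-adjointable, and it is \<open>0\<close> if \<open>A = 0\<close>.\<close>

definition A_numerical_radius :: "('a::chilbert_space \<Rightarrow> 'a) \<Rightarrow> ('a \<Rightarrow> 'a) \<Rightarrow> ennreal" where
  "A_numerical_radius A T = (SUP x \<in> {x. A_norm A x = 1}. ennreal (cmod (A_inner A (T x) x)))"

definition matrix_operator :: "('a::chilbert_space \<Rightarrow> 'a) ^ 'n ^ 'n \<Rightarrow> 'a ^ 'n \<Rightarrow> 'a ^ 'n" where
  "matrix_operator M x = (\<chi> i. \<Sum>j\<in>UNIV. (M $ i $ j) (x $ j))"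

definition diagonal_matrix :: "('a::chilbert_space \<Rightarrow> 'a) \<Rightarrow> ('a \<Rightarrow> 'a) ^ 'n ^ 'n" where
  "diagonal_matrix A = (\<chi> i j. if i = j then A else (\<lambda>_. 0))"

text \<open>The position of an index in the increasing enumeration \<open>1, \<dots>, n\<close> of a linearly ordered
  index type with \<open>n\<close> elements.\<close>

definition index_pos :: "'n::{finite, linorder} \<Rightarrow> nat" where
  "index_pos i = card {..i}"

text \<open>For even \<open>n\<close> the diagonal and the anti-diagonal do not meet; for \<open>n = 2\<close> they exhaust the matrix
  and no entry equals \<open>S\<close>.\<close>

definition cross_matrix ::
  "('a::chilbert_space \<Rightarrow> 'a) \<Rightarrow> ('a \<Rightarrow> 'a) \<Rightarrow> ('a \<Rightarrow> 'a) \<Rightarrow> ('a \<Rightarrow> 'a) ^ ('n::{finite, linorder}) ^ ('n::{finite, linorder})"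
  where
  "cross_matrix R S T = (\<chi> i j.
     if index_pos j = index_pos i then R
     else if index_pos j = CARD('n) + 1 - index_pos i then T
     else S)"

end

theory Submission
  imports Defs
begin

text \<open>
  Let \<open>\<sigma>\<close> be the order reversal of the index set; it is an involution, and it has no fixed point
  because \<open>n\<close> is even.  The cross matrix acts by
  \<open>(M x)\<^sub>i = R x\<^sub>i + T x\<^bsub>\<sigma> i\<^esub> + S (\<Sum>\<^sub>j x\<^sub>j - x\<^sub>i - x\<^bsub>\<sigma> i\<^esub>)\<close>, so it only involves the scalar
  permutation matrix of \<open>\<sigma>\<close> and the all-ones matrix.  These commute and are symmetric, and their
  joint eigenspaces consist of the constant vectors, of the \<open>\<sigma>\<close>-symmetric vectors with sum \<open>0\<close>, and
  of the \<open>\<sigma>\<close>-antisymmetric vectors.  On these three mutually orthogonal subspaces \<open>M\<close> acts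
  componentwise, by \<open>R + T + (n - 2) S\<close>, by \<open>R + T - 2 S\<close> and by \<open>R - T\<close> respectively.

  The value \<open>\<langle>M x, x\<rangle>\<close> for the semi-inner product of the diagonal matrix is therefore a sum of values
  of the forms of these three operators, at vectors whose squared \<open>A\<close>-seminorms add up to that
  of \<open>x\<close> (\<open>cross_form_orthogonal_splitting\<close>); this bounds the radius of \<open>M\<close> by the maximum.
  Conversely, each of the three eigenspaces contains a real unit vector \<open>c\<close>, and
  \<open>z \<mapsto> (c\<^sub>i z)\<^sub>i\<close> is an isometry that carries the form of the corresponding operator to the
  form of \<open>M\<close> (\<open>radius_le_of_scalar_eigenvector\<close>).  The eigenspace of symmetric vectors with sum
  \<open>0\<close> is nonzero because \<open>n \<ge> 4\<close>.

  Since \<open>\<parallel>\<cdot>\<parallel>\<^sub>A\<close> is only a seminorm, the homogeneous bound \<open>|\<langle>T z, z\<rangle>\<^sub>A| \<le> w\<^sub>A(T) \<parallel>z\<parallel>\<^sub>A\<^sup>2\<close> needs an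
  argument at vectors with \<open>\<parallel>z\<parallel>\<^sub>A = 0\<close>: there the positivity of \<open>A\<close> makes the left-hand side
  vanish (\<open>positive_null_vector\<close>).
\<close>

section \<open>The inner product\<close>

lemma cinner_add_right: "cinner x (y + z) = cinner x y + cinner x (z::'a::chilbert_space)"
  by (metis cinner_add_left cinner_commute complex_cnj_add)

lemma cinner_scaleC_right: "cinner x (c *\<^sub>C y) = cnj c * cinner x (y::'a::chilbert_space)"
  by (metis cinner_scaleC_left cinner_commute complex_cnj_mult)

lemma cinner_scaleR_left: "cinner (r *\<^sub>R x) y = of_real r * cinner x (y::'a::chilbert_space)"
  by (metis cinner_scaleC_left scaleC_of_real)

lemma cinner_scaleR_right: "cinner x (r *\<^sub>R y) = of_real r * cinner x (y::'a::chilbert_space)"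
  by (metis cinner_scaleC_right scaleC_of_real complex_cnj_complex_of_real)

lemma cinner_minus_right: "cinner x (- y) = - cinner x (y::'a::chilbert_space)"
  using cinner_scaleR_right[of x "-1" y] by simp

lemma cinner_sum_left: "cinner (sum f I) y = (\<Sum>i\<in>I. cinner (f i) (y::'a::chilbert_space))"
proof (rule Modules.additive.sum)
  show "Modules.additive (\<lambda>x. cinner x y)"
    by unfold_locales (rule cinner_add_left)
qed

lemma cinner_sum_right: "cinner x (sum f I) = (\<Sum>i\<in>I. cinner (x::'a::chilbert_space) (f i))"
proof (rule Modules.additive.sum)
  show "Modules.additive (cinner x)"
    by unfold_locales (rule cinner_add_right)
qed

lemma bounded_operators_linear: "T \<in> bounded_operators \<Longrightarrow> linear T"
  by (simp add: bounded_operators_def bounded_linear.linear)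

lemma positive_operator_linear: "positive_operator A \<Longrightarrow> linear A"
  by (simp add: positive_operator_def bounded_operators_linear)

lemma positive_operator_form:
  assumes "positive_operator A"
  shows "0 \<le> Re (cinner (A x) x)" "Im (cinner (A x) x) = 0"
  using assms by (auto simp: positive_operator_def complex_nonneg_Reals_iff)

section \<open>Homogeneous form of the numerical radius\<close>

lemma affine_nonneg_imp_slope_zero:
  fixes q k :: real
  assumes "\<And>t. 0 \<le> q + t * k"
  shows "k = 0"
proof (rule ccontr)
  assume "k \<noteq> 0"
  then have "q + (- (q + 1) / k) * k = -1"
    by simp
  then show False
    using assms[of "- (q + 1) / k"] by simp
qed

text \<open>On the line \<open>y + t c z\<close> with \<open>t\<close> real the quadratic form of \<open>A\<close> is affine in \<open>t\<close>, as
  \<open>\<langle>A z, z\<rangle> = 0\<close>; being real and nonnegative, it is constant.  The directions \<open>c = 1\<close> and \<open>c = \<i>\<close>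
  give \<open>\<langle>A z, y\<rangle> + \<langle>A y, z\<rangle> = 0\<close> and \<open>\<langle>A z, y\<rangle> - \<langle>A y, z\<rangle> = 0\<close>.\<close>

lemma positive_null_vector:
  fixes A :: "'a::chilbert_space \<Rightarrow> 'a"
  assumes A: "positive_operator A" and null: "Re (cinner (A z) z) = 0"
  shows "cinner (A y) z = 0"
proof -
  have lin: "linear A"
    by (rule positive_operator_linear[OF A])
  have homogeneous: "A (c *\<^sub>C x) = c *\<^sub>C A x" for c x
    using A by (simp add: positive_operator_def bounded_operators_def)
  have zero: "cinner (A z) z = 0"
    using null positive_operator_form(2)[OF A] by (simp add: complex_eq_iff)
  have mixed: "c * cinner (A z) y + cnj c * cinner (A y) z = 0" (is "?k = 0") for c
  proof -
    have expand: "cinner (A (y + t *\<^sub>R (c *\<^sub>C z))) (y + t *\<^sub>R (c *\<^sub>C z)) =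
        cinner (A y) y + of_real t * ?k" for t
      by (simp add: linear_add[OF lin] linear_cmul[OF lin] homogeneous cinner_add_left
          cinner_add_right cinner_scaleR_left cinner_scaleR_right cinner_scaleC_left
          cinner_scaleC_right zero algebra_simps)
    have "Re ?k = 0"
    proof (rule affine_nonneg_imp_slope_zero)
      show "0 \<le> Re (cinner (A y) y) + t * Re ?k" for t
        using positive_operator_form(1)[OF A, of "y + t *\<^sub>R (c *\<^sub>C z)"] unfolding expand
        by simp
    qed
    moreover have "Im ?k = 0"
      using positive_operator_form(2)[OF A, of "y + 1 *\<^sub>R (c *\<^sub>C z)"]
        positive_operator_form(2)[OF A, of y] unfolding expand by simp
    ultimately show ?thesis
      by (simp add: complex_eq_iff)
  qed
  show ?thesis
    using mixed[of 1] mixed[of "\<i>"] by (simp add: complex_eq_iff)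
qed

text \<open>Off the null vectors this is normalisation.  Null vectors are not covered by the supremum, and
  there the right-hand side is \<open>0\<close> even for an infinite radius, because \<open>\<infinity> \<cdot> 0 = 0\<close> in \<open>ennreal\<close>.\<close>

lemma form_le_numerical_radius:
  fixes A B :: "'a::chilbert_space \<Rightarrow> 'a"
  assumes A: "positive_operator A" and B: "linear B"
  shows "ennreal (cmod (cinner (A (B z)) z)) \<le>
    A_numerical_radius A B * ennreal (Re (cinner (A z) z))"
proof (cases "Re (cinner (A z) z) = 0")
  case True
  then show ?thesis
    by (simp add: positive_null_vector[OF A])
next
  case False
  define q where "q = Re (cinner (A z) z)"
  define y where "y = (1 / sqrt q) *\<^sub>R z"
  have q: "q > 0"
    using False positive_operator_form(1)[OF A, of z] by (simp add: q_def)
  have lin: "linear A"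
    by (rule positive_operator_linear[OF A])
  have inv: "complex_of_real (sqrt q) * complex_of_real (sqrt q) = complex_of_real q"
    using q by (simp flip: of_real_mult)
  have "cinner (A y) y = cinner (A z) z / q"
    by (simp add: y_def linear_cmul[OF lin] cinner_scaleR_left cinner_scaleR_right inv)
  then have "A_norm A y = 1"
    using q by (simp add: A_norm_def A_inner_def q_def)
  then have "ennreal (cmod (cinner (A (B y)) y)) \<le> A_numerical_radius A B"
    unfolding A_numerical_radius_def A_inner_def by (intro SUP_upper) simp
  moreover have "cinner (A (B y)) y = cinner (A (B z)) z / q"
    by (simp add: y_def linear_cmul[OF lin] linear_cmul[OF B] cinner_scaleR_left
        cinner_scaleR_right inv)
  ultimately have "ennreal (cmod (cinner (A (B z)) z) / q) \<le> A_numerical_radius A B"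
    using q by (simp add: norm_divide)
  then have "ennreal (cmod (cinner (A (B z)) z) / q) * ennreal q \<le> A_numerical_radius A B * ennreal q"
    by (rule mult_right_mono) simp
  moreover have "ennreal (cmod (cinner (A (B z)) z) / q) * ennreal q =
      ennreal (cmod (cinner (A (B z)) z))"
    using q by (simp flip: ennreal_mult)
  ultimately show ?thesis
    by (simp add: q_def)
qed

section \<open>Reversal of the index set\<close>

lemma index_pos_strict_mono: "i < j \<Longrightarrow> index_pos i < index_pos (j::'n::{finite, linorder})"
  unfolding index_pos_def by (rule psubset_card_mono) auto

lemma inj_index_pos: "inj (index_pos :: 'n::{finite, linorder} \<Rightarrow> nat)"
  by (rule injI) (metis index_pos_strict_mono less_irrefl linorder_cases)

lemma range_index_pos: "range (index_pos :: 'n::{finite, linorder} \<Rightarrow> nat) = {1..CARD('n)}"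
proof (rule card_subset_eq)
  show "range (index_pos :: 'n \<Rightarrow> nat) \<subseteq> {1..CARD('n)}"
  proof clarify
    fix i :: 'n
    have "card {..i} > 0"
      by (simp add: card_gt_0_iff)
    moreover have "card {..i} \<le> CARD('n)"
      by (rule card_mono) auto
    ultimately show "index_pos i \<in> {1..CARD('n)}"
      by (simp add: index_pos_def)
  qed
  show "card (range (index_pos :: 'n \<Rightarrow> nat)) = card {1..CARD('n)}"
    by (simp add: card_image[OF inj_index_pos])
qed simp

definition opposite :: "'n::{finite, linorder} \<Rightarrow> 'n" where
  "opposite i = inv index_pos (CARD('n) + 1 - index_pos i)"

lemma index_pos_bounds: "1 \<le> index_pos (i::'n::{finite, linorder})" "index_pos i \<le> CARD('n)"
  using range_index_pos[where 'n='n] by (auto simp: set_eq_iff)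

lemma index_pos_opposite:
  "index_pos (opposite (i::'n::{finite, linorder})) = CARD('n) + 1 - index_pos i"
  unfolding opposite_def
proof (rule f_inv_into_f)
  show "CARD('n) + 1 - index_pos i \<in> range (index_pos :: 'n \<Rightarrow> nat)"
    unfolding range_index_pos using index_pos_bounds[of i] by auto
qed

lemma index_pos_eq_iff: "index_pos i = index_pos j \<longleftrightarrow> i = (j::'n::{finite, linorder})"
  by (simp add: inj_eq[OF inj_index_pos])

lemma opposite_opposite [simp]: "opposite (opposite i) = (i::'n::{finite, linorder})"
  using index_pos_bounds[of i] by (simp add: index_pos_opposite flip: index_pos_eq_iff)

lemma opposite_eq_iff: "opposite i = j \<longleftrightarrow> i = opposite (j::'n::{finite, linorder})"
  by (metis opposite_opposite)

text \<open>A fixed point would have the position \<open>(n + 1) / 2\<close>.\<close>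

lemma opposite_neq:
  assumes "even (CARD('n::{finite, linorder}))"
  shows "opposite i \<noteq> (i::'n)"
proof
  assume "opposite i = i"
  then have "CARD('n) + 1 = 2 * index_pos i"
    using index_pos_opposite[of i] index_pos_bounds[of i] by simp
  then show False
    using assms by presburger
qed

lemma sum_opposite: "(\<Sum>i\<in>UNIV. f (opposite (i::'n::{finite, linorder}))) = sum f UNIV"
proof (rule sum.reindex_bij_betw)
  show "bij (opposite :: 'n \<Rightarrow> 'n)"
    by (rule o_bij[of opposite]) auto
qed

lemma sum_antisymmetric_zero:
  fixes f :: "'n::{finite, linorder} \<Rightarrow> 'a::real_vector"
  assumes "\<And>i. f (opposite i) = - f i"
  shows "sum f UNIV = 0"
proof -
  have "- sum f UNIV = sum f UNIV"
    using sum_opposite[of f] by (simp add: assms sum_negf)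
  then have "2 *\<^sub>R sum f UNIV = 0"
    by (metis add.right_inverse scaleR_2)
  then show ?thesis
    by simp
qed

section \<open>The cross matrix and its invariant subspaces\<close>

lemma cross_matrix_apply:
  fixes x :: "'a::chilbert_space ^ 'n::{finite, linorder}"
  assumes "even (CARD('n))" and S: "linear S"
  shows "matrix_operator (cross_matrix R S T) x $ i =
    R (x $ i) + T (x $ opposite i) + S ((\<Sum>j\<in>UNIV. x $ j) - x $ i - x $ opposite i)"
proof -
  let ?o = "opposite i" and ?U = "UNIV - {i, opposite i}"
  have ne: "?o \<noteq> i"
    by (rule opposite_neq[OF assms(1)])
  have split: "(\<Sum>j\<in>UNIV. f j) = f i + (f ?o + sum f ?U)" for f :: "'n \<Rightarrow> 'a"
  proof -
    have "sum f UNIV = f i + sum f (UNIV - {i})"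
      by (rule sum.remove) auto
    also have "sum f (UNIV - {i}) = f ?o + sum f (UNIV - {i} - {?o})"
      by (rule sum.remove) (use ne in auto)
    also have "UNIV - {i} - {?o} = ?U"
      by auto
    finally show ?thesis .
  qed
  have entry: "cross_matrix R S T $ i $ j = (if j = i then R else if j = ?o then T else S)" for j
    by (simp only: cross_matrix_def vec_lambda_beta index_pos_eq_iff flip: index_pos_opposite)
  have "(\<Sum>j\<in>?U. (cross_matrix R S T $ i $ j) (x $ j)) = (\<Sum>j\<in>?U. S (x $ j))"
    by (rule sum.cong) (auto simp: entry)
  also have "\<dots> = S (\<Sum>j\<in>?U. x $ j)"
    by (simp add: linear_sum[OF S])
  also have "(\<Sum>j\<in>?U. x $ j) = (\<Sum>j\<in>UNIV. x $ j) - x $ i - x $ ?o"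
    using split[of "\<lambda>j. x $ j"] by simp
  finally show ?thesis
    by (simp add: matrix_operator_def split entry ne)
qed

text \<open>The action of the cross matrix on a joint eigenspace on which the reversal \<open>\<sigma>\<close> acts by \<open>\<epsilon>\<close>, and
  on which the all-ones matrix minus the identity minus \<open>\<sigma>\<close> acts by \<open>\<mu>\<close>.\<close>

definition cross_symbol ::
  "('a::real_vector \<Rightarrow> 'a) \<Rightarrow> ('a \<Rightarrow> 'a) \<Rightarrow> ('a \<Rightarrow> 'a) \<Rightarrow> real \<Rightarrow> real \<Rightarrow> 'a \<Rightarrow> 'a" where
  "cross_symbol R S T \<epsilon> \<mu> x = R x + \<epsilon> *\<^sub>R T x + \<mu> *\<^sub>R S x"

lemma linear_cross_symbol:
  "linear R \<Longrightarrow> linear S \<Longrightarrow> linear T \<Longrightarrow> linear (cross_symbol R S T \<epsilon> \<mu>)"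
  unfolding cross_symbol_def[abs_def]
  by (intro linear_compose_add linear_compose_scale_right)

lemma diagonal_matrix_apply:
  "matrix_operator (diagonal_matrix A) x $ i = A (x $ i)"
proof -
  have "(diagonal_matrix A $ i $ j) (x $ j) = (if j = i then A (x $ j) else 0)" for j
    by (simp add: diagonal_matrix_def)
  then show ?thesis
    by (simp add: matrix_operator_def)
qed

lemma diagonal_form:
  "A_inner (matrix_operator (diagonal_matrix A)) y x = (\<Sum>i\<in>UNIV. cinner (A (y $ i)) (x $ i))"
  by (simp add: A_inner_def cinner_vec_def diagonal_matrix_apply)

section \<open>The upper bound\<close>

text \<open>For fixed \<open>i\<close> the nine products do not simplify; the six mixed ones cancel on
  summation: those of \<open>u\<close> with \<open>v\<^sub>i\<close> because \<open>v\<close> has sum \<open>0\<close>, those with \<open>w\<^sub>i\<close> because they are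
  antisymmetric under the reversal.\<close>

lemma cross_form_orthogonal_splitting:
  fixes u :: "'a::chilbert_space" and v w :: "'n::{finite, linorder} \<Rightarrow> 'a"
  assumes F: "linear F" and G: "linear G" and H: "linear H"
    and v_sum: "sum v UNIV = 0" and v_sym: "\<And>i. v (opposite i) = v i"
    and w_antisym: "\<And>i. w (opposite i) = - w i"
  shows "(\<Sum>i\<in>UNIV. cinner (F u + G (v i) + H (w i)) (u + v i + w i)) =
    (\<Sum>i\<in>(UNIV::'n set). cinner (F u) u + cinner (G (v i)) (v i) + cinner (H (w i)) (w i))"
proof -
  have "(\<Sum>i\<in>UNIV. cinner (F u) (v i)) = 0"
    by (simp add: v_sum flip: cinner_sum_right) (simp add: cinner_scaleR_right[of _ 0, simplified])
  moreover have "(\<Sum>i\<in>UNIV. cinner (G (v i)) u) = 0"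
    by (simp add: v_sum linear_0[OF G] flip: cinner_sum_left linear_sum[OF G])
      (simp add: cinner_scaleR_left[of 0, simplified])
  moreover have "(\<Sum>i\<in>UNIV. cinner (F u + G (v i)) (w i)) = 0"
    by (rule sum_antisymmetric_zero) (simp add: v_sym w_antisym cinner_minus_right)
  moreover have "(\<Sum>i\<in>UNIV. cinner (H (w i)) (u + v i)) = 0"
  proof (rule sum_antisymmetric_zero)
    fix i
    have "H (- w i) = (-1) *\<^sub>R H (w i)"
      by (simp add: linear_neg[OF H])
    then show "cinner (H (w (opposite i))) (u + v (opposite i)) = - cinner (H (w i)) (u + v i)"
      by (simp only: v_sym w_antisym cinner_scaleR_left) simp
  qed
  ultimately show ?thesis
    by (simp add: cinner_add_left cinner_add_right sum.distrib)
qed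

lemma cross_matrix_radius_le:
  fixes A R S T :: "'a::chilbert_space \<Rightarrow> 'a"
    and M :: "('a \<Rightarrow> 'a) ^ ('n::{finite, linorder}) ^ ('n::{finite, linorder})"
  assumes A: "positive_operator A" and R: "linear R" and S: "linear S" and T: "linear T"
    and even: "even (CARD('n))" and M: "M = cross_matrix R S T"
    and const: "A_numerical_radius A (cross_symbol R S T 1 (real (CARD('n)) - 2)) \<le> m"
    and sym: "A_numerical_radius A (cross_symbol R S T 1 (-2)) \<le> m"
    and antisym: "A_numerical_radius A (cross_symbol R S T (-1) 0) \<le> m"
  shows "A_numerical_radius (matrix_operator (diagonal_matrix A)) (matrix_operator M) \<le> m"
  unfolding A_numerical_radius_def
proof (rule SUP_least, clarify)
  fix x :: "'a ^ ('n::{finite, linorder})"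
  assume unit: "A_norm (matrix_operator (diagonal_matrix A)) x = 1"
  let ?n = "real (CARD('n))"
  let ?B = "cross_symbol R S T 1 (?n - 2)" and ?C = "cross_symbol R S T 1 (-2)"
    and ?D = "cross_symbol R S T (-1) 0"
  \<comment> \<open>\<open>u\<close> (repeated in every component), \<open>v\<close> and \<open>w\<close> are the orthogonal projections of \<open>x\<close>
    onto the three joint eigenspaces.\<close>
  define s where "s = (\<Sum>j\<in>UNIV. x $ j)"
  define u where "u = (1 / ?n) *\<^sub>R s"
  define v where "v i = (1/2) *\<^sub>R (x $ i + x $ opposite i) - u" for i
  define w where "w i = (1/2) *\<^sub>R (x $ i - x $ opposite i)" for i
  have x_split: "x $ i = u + v i + w i" for i
    by (simp add: v_def w_def flip: scaleR_add_right scaleR_add_left)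
  have s_split: "s = ?n *\<^sub>R u"
    by (simp add: u_def)
  have v_sym: "v (opposite i) = v i" for i
    by (simp add: v_def add.commute)
  have w_antisym: "w (opposite i) = - w i" for i
    by (simp add: w_def flip: scaleR_minus_right)
  have v_sum: "sum v UNIV = 0"
  proof -
    have "sum v UNIV = (1/2) *\<^sub>R (s + s) - ?n *\<^sub>R u"
      using sum_opposite[of "\<lambda>i. x $ i"]
      by (simp add: v_def s_def sum_subtractf sum.distrib sum_constant_scaleR flip: scaleR_sum_right)
    then show ?thesis
      by (simp add: s_split flip: scaleR_2)
  qed
  have action: "matrix_operator M x $ i = ?B u + ?C (v i) + ?D (w i)" for i
  proof -
    have rest: "s - x $ i - x $ opposite i = (?n - 2) *\<^sub>R u + (-2) *\<^sub>R v i"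
      by (simp add: x_split v_sym w_antisym s_split algebra_simps scaleR_2)
    have "matrix_operator M x $ i =
        R (u + v i + w i) + T (u + v i - w i) + S ((?n - 2) *\<^sub>R u + (-2) *\<^sub>R v i)"
      unfolding M cross_matrix_apply[OF even S] rest[unfolded s_def]
      by (simp add: x_split v_sym w_antisym)
    also have "\<dots> = ?B u + ?C (v i) + ?D (w i)"
      by (simp only: linear_add[OF R] linear_add[OF T] linear_diff[OF T] linear_add[OF S]
          linear_cmul[OF S] cross_symbol_def) (simp add: algebra_simps)
    finally show ?thesis .
  qed
  have linA: "linear A"
    by (rule positive_operator_linear[OF A])
  have linBCD: "linear ?B" "linear ?C" "linear ?D"
    by (rule linear_cross_symbol[OF R S T])+
  let ?q = "\<lambda>z. Re (cinner (A z) z)"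
  have norm_split: "(\<Sum>i\<in>(UNIV::'n set). ?q u + ?q (v i) + ?q (w i)) = 1"
  proof -
    have "A_inner (matrix_operator (diagonal_matrix A)) x x =
        (\<Sum>i\<in>UNIV. cinner (A u + A (v i) + A (w i)) (u + v i + w i))"
      unfolding diagonal_form by (simp add: x_split linear_add[OF linA])
    also have "\<dots> = (\<Sum>i\<in>(UNIV::'n set).
        cinner (A u) u + cinner (A (v i)) (v i) + cinner (A (w i)) (w i))"
      by (rule cross_form_orthogonal_splitting[where v = v and w = w, OF linA linA linA v_sum v_sym w_antisym])
    finally show ?thesis
      using unit by (simp add: A_norm_def)
  qed
  have bound: "ennreal (cmod (cinner (A (F z)) z)) \<le> m * ennreal (?q z)"
    if "linear F" "A_numerical_radius A F \<le> m" for F z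
    using form_le_numerical_radius[OF A that(1), of z] mult_right_mono[OF that(2), of "ennreal (?q z)"]
    by (meson order_trans zero_le)
  have "A_inner (matrix_operator (diagonal_matrix A)) (matrix_operator M x) x =
      (\<Sum>i\<in>UNIV. cinner ((A \<circ> ?B) u + (A \<circ> ?C) (v i) + (A \<circ> ?D) (w i)) (u + v i + w i))"
    unfolding diagonal_form action by (simp add: x_split linear_add[OF linA])
  also have "\<dots> = (\<Sum>i\<in>(UNIV::'n set). cinner ((A \<circ> ?B) u) u + cinner ((A \<circ> ?C) (v i)) (v i)
      + cinner ((A \<circ> ?D) (w i)) (w i))"
    by (rule cross_form_orthogonal_splitting[where v = v and w = w,
          OF linear_compose[OF linBCD(1) linA] linear_compose[OF linBCD(2) linA]
            linear_compose[OF linBCD(3) linA] v_sum v_sym w_antisym])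
  finally have form: "A_inner (matrix_operator (diagonal_matrix A)) (matrix_operator M x) x = \<dots>" .
  have "cmod (A_inner (matrix_operator (diagonal_matrix A)) (matrix_operator M x) x) \<le>
      (\<Sum>i\<in>(UNIV::'n set). cmod (cinner (A (?B u)) u) + cmod (cinner (A (?C (v i))) (v i))
        + cmod (cinner (A (?D (w i))) (w i)))"
    unfolding form comp_def
    by (rule order_trans[OF norm_sum]) (intro sum_mono norm_triangle_le add_mono order_refl)
  then have "ennreal (cmod (A_inner (matrix_operator (diagonal_matrix A)) (matrix_operator M x) x)) \<le>
      (\<Sum>i\<in>(UNIV::'n set). ennreal (cmod (cinner (A (?B u)) u))
        + ennreal (cmod (cinner (A (?C (v i))) (v i))) + ennreal (cmod (cinner (A (?D (w i))) (w i))))"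
    by (simp add: ennreal_leI flip: ennreal_plus)
  also have "\<dots> \<le> (\<Sum>i\<in>(UNIV::'n set).
      m * ennreal (?q u) + m * ennreal (?q (v i)) + m * ennreal (?q (w i)))"
    by (intro sum_mono add_mono bound linBCD const sym antisym)
  also have "\<dots> = m * ennreal (\<Sum>i\<in>(UNIV::'n set). ?q u + ?q (v i) + ?q (w i))"
    by (simp add: positive_operator_form(1)[OF A] distrib_left sum_distrib_left flip: sum_ennreal)
  finally show "ennreal (cmod (A_inner (matrix_operator (diagonal_matrix A))
      (matrix_operator M x) x)) \<le> m"
    by (simp add: norm_split)
qed

section \<open>The lower bounds\<close>

text \<open>A real joint eigenvector \<open>c\<close> of the reversal and of the all-ones matrix spreads a vector \<open>z\<close> to
  \<open>(c\<^sub>i z)\<^sub>i\<close>, on which the cross matrix acts as its symbol acts on \<open>z\<close>.  After normalisation of \<open>c\<close>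
  the factors \<open>c\<^sub>i\<^sup>2\<close> sum to \<open>1\<close>, so both the seminorm and the form are preserved.\<close>

lemma radius_le_of_scalar_eigenvector:
  fixes A R S T :: "'a::chilbert_space \<Rightarrow> 'a" and c :: "'n::{finite, linorder} \<Rightarrow> real"
    and M :: "('a \<Rightarrow> 'a) ^ ('n::{finite, linorder}) ^ ('n::{finite, linorder})"
  assumes A: "linear A" and R: "linear R" and S: "linear S" and T: "linear T"
    and even: "even (CARD('n))" and M: "M = cross_matrix R S T"
    and parity: "\<And>i. c (opposite i) = \<epsilon> * c i"
    and rest: "\<And>i. sum c UNIV - c i - c (opposite i) = \<mu> * c i"
    and nonzero: "c k \<noteq> 0"
  shows "A_numerical_radius A (cross_symbol R S T \<epsilon> \<mu>) \<le>
    A_numerical_radius (matrix_operator (diagonal_matrix A)) (matrix_operator M)"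
  unfolding A_numerical_radius_def[of A]
proof (rule SUP_least, clarify)
  fix z :: 'a
  assume unit: "A_norm A z = 1"
  let ?B = "cross_symbol R S T \<epsilon> \<mu>"
  define N where "N = (\<Sum>i\<in>UNIV. (c i)\<^sup>2)"
  have N: "N > 0"
    unfolding N_def by (rule sum_pos2[of _ k]) (use nonzero in auto)
  define d where "d i = c i / sqrt N" for i
  define x :: "'a ^ ('n::{finite, linorder})" where "x = (\<chi> i. d i *\<^sub>R z)"
  have "(\<Sum>i\<in>UNIV. (d i)\<^sup>2) = 1"
    using N by (simp add: d_def power_divide N_def flip: sum_divide_distrib)
  then have d_unit: "(\<Sum>i\<in>UNIV. complex_of_real (d i) * (complex_of_real (d i) * a)) = a" for a
    by (simp add: power2_eq_square mult.assoc[symmetric] flip: of_real_mult of_real_sum sum_distrib_right)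
  have d_parity: "d (opposite i) = \<epsilon> * d i" for i
    by (simp add: d_def parity)
  have d_rest: "sum d UNIV - d i - d (opposite i) = \<mu> * d i" for i
    by (simp add: d_def rest flip: sum_divide_distrib diff_divide_distrib)
  have action: "matrix_operator M x $ i = d i *\<^sub>R ?B z" for i
  proof -
    have "(\<Sum>j\<in>UNIV. x $ j) - x $ i - x $ opposite i = (\<mu> * d i) *\<^sub>R z"
      unfolding d_rest[symmetric] by (simp add: x_def scaleR_sum_left scaleR_diff_left)
    then show ?thesis
      by (simp add: M cross_matrix_apply[OF even S] linear_cmul[OF S])
        (simp add: x_def d_parity linear_cmul[OF R] linear_cmul[OF T] cross_symbol_def
          algebra_simps)
  qed
  have "A_inner (matrix_operator (diagonal_matrix A)) x x = cinner (A z) z"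
    unfolding diagonal_form
    by (simp add: x_def linear_cmul[OF A] cinner_scaleR_left cinner_scaleR_right d_unit)
  then have "A_norm (matrix_operator (diagonal_matrix A)) x = 1"
    using unit by (simp add: A_norm_def A_inner_def)
  moreover have "A_inner (matrix_operator (diagonal_matrix A)) (matrix_operator M x) x =
      A_inner A (?B z) z"
    unfolding diagonal_form action
    by (simp add: x_def linear_cmul[OF A] cinner_scaleR_left cinner_scaleR_right d_unit A_inner_def)
  ultimately show "ennreal (cmod (A_inner A (?B z) z)) \<le>
      A_numerical_radius (matrix_operator (diagonal_matrix A)) (matrix_operator M)"
    unfolding A_numerical_radius_def by (intro SUP_upper2[of x]) simp_all
qed

text \<open>With \<open>k\<close> and \<open>l\<close> in two different orbits of the reversal, the vector that is \<open>1\<close> on the orbit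
  of \<open>k\<close> and \<open>-1\<close> on the orbit of \<open>l\<close> is symmetric and has sum \<open>0\<close>.\<close>

lemma exists_symmetric_sum_zero:
  fixes k :: "'n::{finite, linorder}"
  assumes even: "even (CARD('n))" and four: "CARD('n) \<ge> 4"
  obtains c :: "'n \<Rightarrow> real"
  where "\<And>i. c (opposite i) = c i" "sum c UNIV = 0" "c k \<noteq> 0"
proof -
  have "card {k, opposite k} < CARD('n)"
    using four card_insert_le_m1[of 2 "{opposite k}" k] by simp
  then obtain l where l: "l \<notin> {k, opposite k}"
    by (metis UNIV_eq_I less_irrefl)
  define c :: "'n \<Rightarrow> real" where
    "c i = of_bool (i \<in> {k, opposite k}) - of_bool (i \<in> {l, opposite l})" for i
  have orbit: "(\<Sum>i\<in>UNIV. of_bool (i \<in> {j, opposite j})) = (2::real)" for j :: 'n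
  proof -
    have "(\<Sum>i\<in>UNIV. of_bool (i \<in> {j, opposite j})) = real (card {j, opposite j})"
      by (simp add: of_bool_def sum.If_cases del: insert_iff)
    also have "card {j, opposite j} = 2"
      using opposite_neq[OF even, of j] by simp
    finally show ?thesis by simp
  qed
  show ?thesis
  proof
    show "c (opposite i) = c i" for i
      unfolding c_def by (auto simp: opposite_eq_iff)
    show "sum c UNIV = 0"
      unfolding c_def sum_subtractf orbit by simp
    show "c k \<noteq> 0"
      using l unfolding c_def by (auto simp: opposite_eq_iff)
  qed
qed

lemma exists_antisymmetric:
  fixes k :: "'n::{finite, linorder}"
  assumes even: "even (CARD('n))"
  obtains c :: "'n \<Rightarrow> real"
  where "\<And>i. c (opposite i) = - c i" "sum c UNIV = 0" "c k \<noteq> 0"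
proof -
  define c :: "'n \<Rightarrow> real" where "c i = of_bool (i = k) - of_bool (i = opposite k)" for i
  have antisym: "c (opposite i) = - c i" for i
    unfolding c_def by (auto simp: opposite_eq_iff)
  show ?thesis
  proof
    show "c (opposite i) = - c i" for i
      by (rule antisym)
    show "sum c UNIV = 0"
      by (rule sum_antisymmetric_zero) (rule antisym)
    show "c k \<noteq> 0"
      using opposite_neq[OF even, of k] by (simp add: c_def)
  qed
qed

section \<open>The numerical radius of the cross matrix\<close>

theorem theorem2p7:
  fixes A R S T :: "'a::chilbert_space \<Rightarrow> 'a"
    and M :: "('a \<Rightarrow> 'a) ^ ('n::{finite, linorder}) ^ ('n::{finite, linorder})"
    and n :: nat
  assumes "positive_operator A"
    and "R \<in> A_adjointable A" and "S \<in> A_adjointable A" and "T \<in> A_adjointable A"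
    and "n = CARD('n)" and "even n" and "n \<ge> 4"
    and "M = cross_matrix R S T"
  shows "A_numerical_radius (matrix_operator (diagonal_matrix A)) (matrix_operator M) =
    Max {A_numerical_radius A (\<lambda>x. R x + T x + (of_nat n - 2) *\<^sub>C S x),
         A_numerical_radius A (\<lambda>x. R x + T x - 2 *\<^sub>C S x),
         A_numerical_radius A (\<lambda>x. R x - T x)}"
proof -
  have R: "linear R" and S: "linear S" and T: "linear T"
    using assms(2-4) by (auto simp: A_adjointable_def intro: bounded_operators_linear)
  have A: "linear A"
    by (rule positive_operator_linear[OF assms(1)])
  have even: "even (CARD('n))"
    using assms by simp
  have const_eq: "(\<lambda>x. R x + T x + (of_nat n - 2) *\<^sub>C S x) = cross_symbol R S T 1 (real CARD('n) - 2)"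
    using scaleC_of_real[of "real n - 2", where 'a='a]
    by (simp add: cross_symbol_def fun_eq_iff assms(5))
  have sym_eq: "(\<lambda>x. R x + T x - 2 *\<^sub>C S x) = cross_symbol R S T 1 (-2)"
    using scaleC_of_real[of 2, where 'a='a] by (simp add: cross_symbol_def fun_eq_iff)
  have antisym_eq: "(\<lambda>x. R x - T x) = cross_symbol R S T (-1) 0"
    by (simp add: cross_symbol_def fun_eq_iff)
  let ?w = "A_numerical_radius (matrix_operator (diagonal_matrix A)) (matrix_operator M)"
  note eigenvector = radius_le_of_scalar_eigenvector[OF A R S T even assms(8)]
  have const: "A_numerical_radius A (cross_symbol R S T 1 (real CARD('n) - 2)) \<le> ?w"
    by (rule eigenvector[of "\<lambda>_. 1"]) simp_all
  fix k :: 'n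
  obtain c :: "'n \<Rightarrow> real"
    where c: "\<And>i. c (opposite i) = c i" "sum c UNIV = 0" "c k \<noteq> 0"
    using exists_symmetric_sum_zero even assms(5,7) by metis
  have sym: "A_numerical_radius A (cross_symbol R S T 1 (-2)) \<le> ?w"
    by (rule eigenvector[of c _ _ k]) (simp_all add: c)
  obtain d :: "'n \<Rightarrow> real"
    where d: "\<And>i. d (opposite i) = - d i" "sum d UNIV = 0" "d k \<noteq> 0"
    using exists_antisymmetric even by metis
  have antisym: "A_numerical_radius A (cross_symbol R S T (-1) 0) \<le> ?w"
    by (rule eigenvector[of d _ _ k]) (simp_all add: d)
  show ?thesis
    unfolding const_eq sym_eq antisym_eq
  proof (rule order_antisym)
    show "?w \<le> Max {A_numerical_radius A (cross_symbol R S T 1 (real CARD('n) - 2)),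
        A_numerical_radius A (cross_symbol R S T 1 (-2)), A_numerical_radius A (cross_symbol R S T (-1) 0)}"
      by (rule cross_matrix_radius_le[OF assms(1) R S T even assms(8)]) (rule Max_ge; simp)+
  qed (use const sym antisym in simp)
qed

end
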